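(* Let $\ell$ be a positive integer. For all integers $n\geq 0$ and all integers $r$ with $\ell\nmid r$, $\overline{R_\ell^\ast}(\ell n+r)\equiv 0 \pmod{2}$.
   Context: An overpartition of $n$ is a partition of $n$ in which the first occurrence of each part size may optionally be overlined. For a positive integer $\ell$, $\overline{R_\ell^\ast}(n)$ denotes the number of overpartitions of $n$ in which no non-overlined part is divisible by $\ell$ (and $\overline{R_\ell^\ast}(m)=0$ for negative integers $m$). Equivalently, with $f_k:=\prod_{i\geq 1}(1-q^{ki})$, one has $\sum_{n\geq 0}\overline{R_\ell^\ast}(n)q^n = \frac{f_2 f_\ell}{f_1^2}$. *)

theory Defs
  imports "HOL-Library.Multiset" "HOL-Number_Theory.Cong"
begin

text \<open>
  An overpartition is encoded as a pair \<open>(M, S)\<close>: \<open>M\<close> is the underlying partition, i.e. the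
  multiset of all parts (overlined or not), and \<open>S\<close> is the set of those part sizes whose first
  occurrence is overlined.
\<close>

definition overpartitions :: "nat \<Rightarrow> (nat multiset \<times> nat set) set" where
  "overpartitions n = {(M, S). (\<forall>k \<in># M. 0 < k) \<and> sum_mset M = n \<and> S \<subseteq> set_mset M}"

text \<open>
  One copy of each size in \<open>S\<close> is overlined, so removing \<open>mset_set S\<close> (each element of the
  finite set \<open>S\<close> once) leaves exactly the non-overlined parts.
\<close>

definition non_overlined_parts :: "nat multiset \<times> nat set \<Rightarrow> nat multiset" where
  "non_overlined_parts p = fst p - mset_set (snd p)"

definition restricted_overpartitions :: "nat \<Rightarrow> nat \<Rightarrow> (nat multiset \<times> nat set) set" where
  "restricted_overpartitions l n =
     {p \<in> overpartitions n. \<forall>k \<in># non_overlined_parts p. \<not> l dvd k}"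

definition Rstar :: "nat \<Rightarrow> int \<Rightarrow> nat" where
  "Rstar l m = (if m < 0 then 0 else card (restricted_overpartitions l (nat m)))"

text \<open>Finiteness ensures that \<open>card\<close> in the definition of \<open>Rstar\<close> is a genuine count.\<close>

lemma size_le_sum_mset:
  fixes M :: "nat multiset"
  assumes "\<forall>k \<in># M. 0 < k"
  shows "size M \<le> sum_mset M"
  using assms by (induction M) auto

lemma finite_overpartitions: "finite (overpartitions n)"
proof -
  have "overpartitions n \<subseteq>
      mset ` {xs. set xs \<subseteq> {..n} \<and> length xs \<le> n} \<times> Pow {..n}"
  proof
    fix p assume "p \<in> overpartitions n"
    then obtain M S where p: "p = (M, S)" and pos: "\<forall>k \<in># M. 0 < k"
      and sum: "sum_mset M = n" and S: "S \<subseteq> set_mset M"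
      by (auto simp: overpartitions_def)
    have le: "set_mset M \<subseteq> {..n}"
    proof
      fix k assume "k \<in># M"
      then obtain M' where "M = add_mset k M'" by (blast dest: multi_member_split)
      then show "k \<in> {..n}" using sum by auto
    qed
    obtain xs where xs: "M = mset xs" using ex_mset[of M] by blast
    have len: "length xs \<le> n" using size_le_sum_mset[OF pos] sum xs by simp
    have "set xs \<subseteq> {..n}" using le unfolding xs by simp
    then have "M \<in> mset ` {xs. set xs \<subseteq> {..n} \<and> length xs \<le> n}"
      unfolding xs using len by (intro imageI CollectI conjI)
    moreover have "S \<in> Pow {..n}" using S le by (intro PowI) (rule subset_trans)
    ultimately show "p \<in> mset ` {xs. set xs \<subseteq> {..n} \<and> length xs \<le> n} \<times> Pow {..n}"
      unfolding p by (rule SigmaI)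
  qed
  moreover have "finite {xs. set xs \<subseteq> {..n} \<and> length xs \<le> n}"
    by (rule finite_lists_length_le) simp
  ultimately show ?thesis
    by (elim finite_subset) (intro finite_cartesian_product finite_imageI, simp_all)
qed

lemma finite_restricted_overpartitions: "finite (restricted_overpartitions l n)"
  unfolding restricted_overpartitions_def using finite_overpartitions by simp

end

theory Submission
  imports Defs
begin

text \<open>
  Toggling the overline on the smallest part size not divisible by \<open>l\<close> is an involution without
  fixed points as soon as such a part exists, and one exists whenever \<open>l\<close> does not divide the
  number being partitioned. The restriction concerns only multiples of \<open>l\<close>, so it is preserved.
\<close>

text \<open>\<open>P\<close> flips along \<open>f\<close>, so \<open>f\<close> matches the elements
  satisfying \<open>P\<close> with those violating it, and the two halves have equal size.\<close>

lemma even_card_fixpoint_free_involution: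
  assumes "finite A"
    and "\<And>x. x \<in> A \<Longrightarrow> f x \<in> A"
    and "\<And>x. x \<in> A \<Longrightarrow> f (f x) = x"
    and "\<And>x. x \<in> A \<Longrightarrow> P (f x) \<longleftrightarrow> \<not> P x"
  shows "even (card A)"
proof -
  have "bij_betw f {x \<in> A. P x} {x \<in> A. \<not> P x}"
    using assms by (intro bij_betw_byWitness[where f' = f]) auto
  then have "card {x \<in> A. \<not> P x} = card {x \<in> A. P x}"
    by (simp add: bij_betw_same_card)
  moreover have "card A = card {x \<in> A. P x} + card {x \<in> A. \<not> P x}"
    using assms(1) by (subst card_Un_disjoint[symmetric]) (auto intro: arg_cong[where f = card])
  ultimately show ?thesis by simp
qed

lemma dvd_sum_mset:
  fixes M :: "'a::comm_semiring_1 multiset"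
  assumes "\<forall>k \<in># M. d dvd k"
  shows "d dvd sum_mset M"
  using assms by (induction M) auto

text \<open>Trades the multiset difference for multiplicities: a multiple of \<open>l\<close> occurs
  at most once, and then overlined. In this form the restriction sees \<open>S\<close> only through
  the multiples of \<open>l\<close>.\<close>

lemma restricted_overpartitions_iff:
  "(M, S) \<in> restricted_overpartitions l n \<longleftrightarrow>
     (\<forall>k \<in># M. 0 < k) \<and> sum_mset M = n \<and> S \<subseteq> set_mset M \<and>
     (\<forall>k. l dvd k \<longrightarrow> count M k \<le> of_bool (k \<in> S))"
proof (cases "S \<subseteq> set_mset M")
  case True
  \<comment> \<open>\<open>mset_set\<close> of an infinite set is empty, so the count below relies
    on this.\<close>
  then have "finite S" by (rule finite_subset) simp
  then have "k \<in># M - mset_set S \<longleftrightarrow> \<not> count M k \<le> of_bool (k \<in> S)" for k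
    by (simp add: count_mset_set' in_diff_count not_le)
  then have "(\<forall>k \<in># M - mset_set S. \<not> l dvd k) \<longleftrightarrow>
      (\<forall>k. l dvd k \<longrightarrow> count M k \<le> of_bool (k \<in> S))"
    by blast
  then show ?thesis
    by (auto simp: restricted_overpartitions_def overpartitions_def non_overlined_parts_def)
qed (auto simp: restricted_overpartitions_def overpartitions_def)

lemma even_card_restricted_overpartitions:
  assumes "\<not> l dvd n"
  shows "even (card (restricted_overpartitions l n))"
proof -
  \<comment> \<open>The choice depends on \<open>M\<close> alone, which \<open>toggle\<close> keeps,
    so toggling twice acts on the same part and restores \<open>S\<close>.\<close>
  define part where "part M = Min {k \<in> set_mset M. \<not> l dvd k}" for M
  define toggle where
    "toggle = (\<lambda>(M, S). (M, if part M \<in> S then S - {part M} else insert (part M) S))"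
  have part: "part M \<in># M \<and> \<not> l dvd part M" if "sum_mset M = n" for M
  proof -
    have "\<exists>k \<in># M. \<not> l dvd k"
      using assms that by (metis dvd_sum_mset)
    then show ?thesis
      using Min_in[of "{k \<in> set_mset M. \<not> l dvd k}"] by (auto simp: part_def)
  qed
  show ?thesis
  proof (rule even_card_fixpoint_free_involution
      [where f = toggle and P = "\<lambda>(M, S). part M \<in> S"])
    show "toggle p \<in> restricted_overpartitions l n"
      if "p \<in> restricted_overpartitions l n" for p
    proof (cases p)
      case (Pair M S)
      with that have M: "(M, S) \<in> restricted_overpartitions l n" by simp
      then have "part M \<in># M" "\<not> l dvd part M"
        using part by (auto simp: restricted_overpartitions_iff)
      \<comment> \<open>Only the membership of \<open>part M\<close> changes, and it is no multiple
        of \<open>l\<close>.\<close>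
      then have "k \<in> snd (toggle (M, S)) \<longleftrightarrow> k \<in> S" if "l dvd k" for k
        using that by (auto simp: toggle_def)
      with M \<open>part M \<in># M\<close> show ?thesis
        unfolding Pair by (auto simp: restricted_overpartitions_iff toggle_def)
    qed
  qed (auto simp: finite_restricted_overpartitions toggle_def split: if_splits)
qed

theorem theorem1p4:
  fixes l n :: nat and r :: int
  assumes "l > 0" and "\<not> int l dvd r"
  shows "[Rstar l (int l * int n + r) = 0] (mod 2)"
proof (cases "int l * int n + r < 0")
  \<comment> \<open>A negative \<open>r\<close> can make the argument negative; that case holds
    because \<open>Rstar\<close> is then 0 by definition.\<close>
  case False
  have "\<not> int l dvd int l * int n + r"
    using assms(2) by (simp add: dvd_add_right_iff)
  with False have "\<not> l dvd nat (int l * int n + r)"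
    by (metis int_nat_eq int_dvd_int_iff not_less)
  from even_card_restricted_overpartitions[OF this] False show ?thesis
    by (simp add: Rstar_def cong_0_iff)
qed (simp add: Rstar_def)

end
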